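(* Let $\mathbb{F}$ be a field and $d\ge 0$ an integer. Each diagonal equivalence class of solid invertible matrices in $\mathrm{Mat}_{d+1}(\mathbb{F})$ contains a unique normalized element.
   Context: $\mathrm{Mat}_{d+1}(\mathbb{F})$ is the algebra of $(d+1)\times(d+1)$ matrices over $\mathbb{F}$, with rows and columns indexed by $0,1,\ldots,d$. An invertible $R\in\mathrm{Mat}_{d+1}(\mathbb{F})$ is solid if for both $R$ and $R^{-1}$ all entries in column $0$ and in row $0$ are nonzero. Matrices $S,T \in \mathrm{Mat}_{d+1}(\mathbb{F})$ are diagonally equivalent if $T=HSK$ for some invertible diagonal matrices $H,K\in \mathrm{Mat}_{d+1}(\mathbb{F})$; any matrix diagonally equivalent to a solid invertible matrix is solid invertible. A solid invertible matrix $R$ is normalized if all entries in column $0$ of $R$ are equal to $1$ and all entries in column $0$ of $R^{-1}$ are the same. *)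

theory Defs
  imports "Jordan_Normal_Form.Gauss_Jordan_Elimination"
begin

(* mat_inverse returns an option: Some of the two-sided inverse for an invertible
   square matrix, None otherwise.  See mat_inv_inverse and mat_inv_eqI. *)
definition mat_inv :: "'a::field mat \<Rightarrow> 'a mat" where
  "mat_inv R = the (mat_inverse R)"

definition solid_inv :: "nat \<Rightarrow> 'a::field mat \<Rightarrow> bool" where
  "solid_inv d R \<longleftrightarrow>
     R \<in> carrier_mat (d + 1) (d + 1) \<and> invertible_mat R \<and>
     (\<forall>i\<le>d. R $$ (i, 0) \<noteq> 0 \<and> R $$ (0, i) \<noteq> 0) \<and>
     (\<forall>i\<le>d. mat_inv R $$ (i, 0) \<noteq> 0 \<and> mat_inv R $$ (0, i) \<noteq> 0)"

definition diag_equiv :: "nat \<Rightarrow> ('a::field mat \<times> 'a mat) set" where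
  "diag_equiv d = {(S, T).
     S \<in> carrier_mat (d + 1) (d + 1) \<and> T \<in> carrier_mat (d + 1) (d + 1) \<and>
     (\<exists>H K. H \<in> carrier_mat (d + 1) (d + 1) \<and> K \<in> carrier_mat (d + 1) (d + 1) \<and>
            diagonal_mat H \<and> invertible_mat H \<and> diagonal_mat K \<and> invertible_mat K \<and>
            T = H * S * K)}"

definition normalized :: "nat \<Rightarrow> 'a::field mat \<Rightarrow> bool" where
  "normalized d R \<longleftrightarrow>
     solid_inv d R \<and>
     (\<forall>i\<le>d. R $$ (i, 0) = 1) \<and>
     (\<forall>i\<le>d. \<forall>j\<le>d. mat_inv R $$ (i, 0) = mat_inv R $$ (j, 0))"

lemma invertible_matE:
  assumes A: "A \<in> carrier_mat n n" and inv: "invertible_mat A"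
  obtains B where "B \<in> carrier_mat n n" "A * B = 1\<^sub>m n" "B * A = 1\<^sub>m n"
proof -
  from inv obtain B where AB: "A * B = 1\<^sub>m (dim_row A)" and BA: "B * A = 1\<^sub>m (dim_row B)"
    unfolding invertible_mat_def inverts_mat_def by blast
  have "dim_col B = n" using arg_cong[OF AB, of dim_col] A by simp
  moreover have "dim_row B = n" using arg_cong[OF BA, of dim_col] A by simp
  ultimately show thesis using that[of B] AB BA A by auto
qed

lemma invertible_matI:
  assumes "A \<in> carrier_mat n n" "B \<in> carrier_mat n n" "A * B = 1\<^sub>m n" "B * A = 1\<^sub>m n"
  shows "invertible_mat A"
  using assms unfolding invertible_mat_def inverts_mat_def by auto

lemma mat_inv_eqI:
  assumes A: "A \<in> carrier_mat n n" and B: "B \<in> carrier_mat n n"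
    and AB: "A * B = 1\<^sub>m n" and BA: "B * A = 1\<^sub>m n"
  shows "mat_inv A = B"
proof -
  have "A \<in> Units (ring_mat TYPE('a) n (undefined :: unit))"
    using assms unfolding Units_def ring_mat_def by auto
  then obtain C where C: "mat_inverse A = Some C"
    using mat_inverse(1)[OF A, of "undefined :: unit"] by (cases "mat_inverse A") auto
  from mat_inverse(2)[OF A C] have C': "A * C = 1\<^sub>m n" "C \<in> carrier_mat n n" by auto
  have "C = (B * A) * C" using BA C' by simp
  also have "\<dots> = B * (A * C)" using A B C' by (simp add: assoc_mult_mat)
  also have "\<dots> = B" using B C' by simp
  finally show ?thesis unfolding mat_inv_def C by simp
qed

lemma mat_inv_inverse:
  assumes "A \<in> carrier_mat n n" "invertible_mat A"
  shows "mat_inv A \<in> carrier_mat n n" "A * mat_inv A = 1\<^sub>m n" "mat_inv A * A = 1\<^sub>m n"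
  using assms by (metis invertible_matE mat_inv_eqI)+

lemma invertible_mat_mult:
  assumes A: "A \<in> carrier_mat n n" "invertible_mat A"
    and B: "B \<in> carrier_mat n n" "invertible_mat (B :: 'a::field mat)"
  shows "invertible_mat (A * B)"
proof -
  obtain A' where A': "A' \<in> carrier_mat n n" "A * A' = 1\<^sub>m n" "A' * A = 1\<^sub>m n"
    by (rule invertible_matE[OF A])
  obtain B' where B': "B' \<in> carrier_mat n n" "B * B' = 1\<^sub>m n" "B' * B = 1\<^sub>m n"
    by (rule invertible_matE[OF B])
  have "(A * B) * (B' * A') = A * ((B * B') * A')"
    using A(1) B(1) A'(1) B'(1) by (simp add: assoc_mult_mat[of _ n n _ n _ n])
  moreover have "(B' * A') * (A * B) = B' * ((A' * A) * B)"
    using A(1) B(1) A'(1) B'(1) by (simp add: assoc_mult_mat[of _ n n _ n _ n])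
  ultimately show ?thesis
    using A B A' B' by (intro invertible_matI[of _ n "B' * A'"]) auto
qed

lemma diagonal_mat_mult_entry:
  assumes H: "H \<in> carrier_mat n n" "diagonal_mat H" and A: "A \<in> carrier_mat n n"
    and "i < n" "j < n"
  shows "(H * A) $$ (i, j) = H $$ (i, i) * (A $$ (i, j) :: 'a::field)"
    and "(A * H) $$ (i, j) = A $$ (i, j) * H $$ (j, j)"
proof -
  have "(H * A) $$ (i, j) = (\<Sum>k<n. H $$ (i, k) * A $$ (k, j))"
    using assms by (auto simp: scalar_prod_def atLeast0LessThan)
  also have "\<dots> = (\<Sum>k<n. if k = i then H $$ (i, i) * A $$ (i, j) else 0)"
    using assms by (intro sum.cong) (auto simp: diagonal_mat_def)
  finally show "(H * A) $$ (i, j) = H $$ (i, i) * A $$ (i, j)"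
    using assms by simp
  have "(A * H) $$ (i, j) = (\<Sum>k<n. A $$ (i, k) * H $$ (k, j))"
    using assms by (auto simp: scalar_prod_def atLeast0LessThan)
  also have "\<dots> = (\<Sum>k<n. if k = j then A $$ (i, j) * H $$ (j, j) else 0)"
    using assms by (intro sum.cong) (auto simp: diagonal_mat_def)
  finally show "(A * H) $$ (i, j) = A $$ (i, j) * H $$ (j, j)"
    using assms by simp
qed

lemma diagonal_mat_mult:
  assumes "H \<in> carrier_mat n n" "diagonal_mat H" "K \<in> carrier_mat n n"
    and "diagonal_mat (K :: 'a::field mat)"
  shows "diagonal_mat (H * K)"
  unfolding diagonal_mat_def
proof (intro allI impI)
  fix i j assume "i < dim_row (H * K)" "j < dim_col (H * K)" "i \<noteq> j"
  then show "(H * K) $$ (i, j) = 0"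
    using assms diagonal_mat_mult_entry(1)[OF assms(1,2,3), of i j]
    by (auto simp: diagonal_mat_def)
qed

lemma diagonal_mat_inverse:
  assumes H: "H \<in> carrier_mat n n" "diagonal_mat H" and B: "B \<in> carrier_mat n n"
    and HB: "H * B = 1\<^sub>m n"
  shows "diagonal_mat (B :: 'a::field mat)"
  unfolding diagonal_mat_def
proof (intro allI impI)
  fix i j assume ij: "i < dim_row B" "j < dim_col B" "i \<noteq> j"
  then have l: "i < n" "j < n" using B by auto
  have "H $$ (i, i) * B $$ (i, i) = 1" "H $$ (i, i) * B $$ (i, j) = 0"
    using diagonal_mat_mult_entry(1)[OF H B l(1) l(1)] diagonal_mat_mult_entry(1)[OF H B l]
      HB l ij(3) by simp_all
  then show "B $$ (i, j) = 0" by auto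
qed

lemma equiv_diag_equiv:
  "equiv (carrier_mat (d + 1) (d + 1)) (diag_equiv d :: ('a::field mat \<times> 'a mat) set)"
proof -
  define n where "n = d + 1"
  have inv1: "invertible_mat (1\<^sub>m n :: 'a mat)"
    by (rule invertible_matI[of _ n "1\<^sub>m n"]) auto
  have diag1: "diagonal_mat (1\<^sub>m n :: 'a mat)"
    by (auto simp: diagonal_mat_def)
  have D: "diag_equiv d = {(S, T :: 'a mat). S \<in> carrier_mat n n \<and> T \<in> carrier_mat n n \<and>
     (\<exists>H K. H \<in> carrier_mat n n \<and> K \<in> carrier_mat n n \<and>
            diagonal_mat H \<and> invertible_mat H \<and> diagonal_mat K \<and> invertible_mat K \<and>
            T = H * S * K)}"
    unfolding diag_equiv_def n_def ..
  show ?thesis unfolding n_def[symmetric]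
  proof (rule equivI)
    show "diag_equiv d \<subseteq> carrier_mat n n \<times> (carrier_mat n n :: 'a mat set)"
      unfolding D by auto
    show "refl_on (carrier_mat n n) (diag_equiv d :: ('a mat \<times> 'a mat) set)"
    proof (rule refl_onI)
      fix S :: "'a mat" assume S: "S \<in> carrier_mat n n"
      then have "S = 1\<^sub>m n * S * 1\<^sub>m n" by simp
      then show "(S, S) \<in> diag_equiv d"
        unfolding D using S inv1 diag1 one_carrier_mat by blast
    qed
    show "sym (diag_equiv d :: ('a mat \<times> 'a mat) set)"
    proof (rule symI)
      fix S T :: "'a mat" assume "(S, T) \<in> diag_equiv d"
      then obtain H K where S: "S \<in> carrier_mat n n" and T: "T \<in> carrier_mat n n"
        and H: "H \<in> carrier_mat n n" "diagonal_mat H" "invertible_mat H"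
        and K: "K \<in> carrier_mat n n" "diagonal_mat K" "invertible_mat K"
        and eq: "T = H * S * K" unfolding D by auto
      obtain H' where H': "H' \<in> carrier_mat n n" "H * H' = 1\<^sub>m n" "H' * H = 1\<^sub>m n"
        by (rule invertible_matE[OF H(1,3)])
      obtain K' where K': "K' \<in> carrier_mat n n" "K * K' = 1\<^sub>m n" "K' * K = 1\<^sub>m n"
        by (rule invertible_matE[OF K(1,3)])
      have "H' * T * K' = (H' * H) * S * (K * K')"
        using S H(1) K(1) H'(1) K'(1) unfolding eq by (simp add: assoc_mult_mat[of _ n n _ n _ n])
      then have "S = H' * T * K'" using S H' K' by simp
      moreover have "diagonal_mat H'" "diagonal_mat K'"
        using diagonal_mat_inverse H H' K K' by blast+
      moreover have "invertible_mat H'" "invertible_mat K'"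
        using invertible_matI H H' K K' by blast+
      ultimately show "(T, S) \<in> diag_equiv d"
        unfolding D using S T H'(1) K'(1) by blast
    qed
    show "trans (diag_equiv d :: ('a mat \<times> 'a mat) set)"
    proof (rule transI)
      fix S T U :: "'a mat" assume "(S, T) \<in> diag_equiv d" "(T, U) \<in> diag_equiv d"
      then obtain H K H' K' where S: "S \<in> carrier_mat n n" and U: "U \<in> carrier_mat n n"
        and H: "H \<in> carrier_mat n n" "diagonal_mat H" "invertible_mat H"
        and K: "K \<in> carrier_mat n n" "diagonal_mat K" "invertible_mat K"
        and H': "H' \<in> carrier_mat n n" "diagonal_mat H'" "invertible_mat H'"
        and K': "K' \<in> carrier_mat n n" "diagonal_mat K'" "invertible_mat K'"
        and eq: "U = H' * (H * S * K) * K'" unfolding D by auto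
      have "U = (H' * H) * S * (K * K')"
        using S H(1) K(1) H'(1) K'(1) unfolding eq by (simp add: assoc_mult_mat[of _ n n _ n _ n])
      moreover have "H' * H \<in> carrier_mat n n" "K * K' \<in> carrier_mat n n"
        using H(1) K(1) H'(1) K'(1) by auto
      moreover have "diagonal_mat (H' * H)" "diagonal_mat (K * K')"
        using diagonal_mat_mult H H' K K' by blast+
      moreover have "invertible_mat (H' * H)" "invertible_mat (K * K')"
        using invertible_mat_mult H H' K K' by blast+
      ultimately show "(S, U) \<in> diag_equiv d"
        unfolding D using S U by blast
    qed
  qed
qed

end

theory Submission
  imports Defs "Jordan_Normal_Form.Determinant"
begin

text \<open>
  If \<open>T = H S K\<close>, with diagonal entries \<open>h\<^sub>i\<close> of \<open>H\<close> and \<open>k\<^sub>i\<close> of \<open>K\<close>, then \<open>T\<^sub>i\<^sub>j = h\<^sub>i S\<^sub>i\<^sub>j k\<^sub>j\<close>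
  and, inverting, \<open>(S\<^sup>-\<^sup>1)\<^sub>i\<^sub>j = k\<^sub>i (T\<^sup>-\<^sup>1)\<^sub>i\<^sub>j h\<^sub>j\<close>. Reading off column \<open>0\<close>, the choice
  \<open>h\<^sub>i = 1 / S\<^sub>i\<^sub>0\<close> and \<open>k\<^sub>i = (S\<^sup>-\<^sup>1)\<^sub>i\<^sub>0 / (S\<^sup>-\<^sup>1)\<^sub>0\<^sub>0\<close> makes \<open>T\<close> normalized. Conversely, if \<open>S\<close> and \<open>T\<close> are both normalized, then the two identities
  force \<open>h\<^sub>i k\<^sub>0 = 1\<close> and \<open>k\<^sub>i = k\<^sub>0\<close>, hence \<open>T = S\<close>.
\<close>

lemma diagonal_mat_sandwich_entry:
  fixes A :: "'a::field mat"
  assumes "H \<in> carrier_mat n n" "diagonal_mat H" "K \<in> carrier_mat n n" "diagonal_mat K"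
    and "A \<in> carrier_mat n n" "i < n" "j < n"
  shows "(H * A * K) $$ (i, j) = H $$ (i, i) * A $$ (i, j) * K $$ (j, j)"
proof -
  have "H * A \<in> carrier_mat n n"
    using assms by simp
  then show ?thesis
    using diagonal_mat_mult_entry(2)[OF assms(3,4) _ assms(6,7), of "H * A"]
      diagonal_mat_mult_entry(1)[OF assms(1,2,5,6,7)] by simp
qed

lemma diagonal_mat_diag_nonzero:
  fixes H :: "'a::field mat"
  assumes H: "H \<in> carrier_mat n n" "diagonal_mat H" "invertible_mat H" and i: "i < n"
  shows "H $$ (i, i) \<noteq> 0"
proof -
  obtain B where B: "B \<in> carrier_mat n n" "H * B = 1\<^sub>m n"
    by (rule invertible_matE[OF H(1,3)])
  have "H $$ (i, i) * B $$ (i, i) = 1"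
    using diagonal_mat_mult_entry(1)[OF H(1,2) B(1) i i] B(2) i by simp
  then show ?thesis by auto
qed

lemma mat_diag_diagonal_mat: "diagonal_mat (mat_diag n f)"
  by (auto simp: diagonal_mat_def mat_diag_def)

lemma invertible_mat_diag:
  fixes f :: "nat \<Rightarrow> 'a::field"
  assumes "\<And>i. i < n \<Longrightarrow> f i \<noteq> 0"
  shows "invertible_mat (mat_diag n f)"
proof (rule invertible_matI)
  show "mat_diag n f * mat_diag n (\<lambda>i. inverse (f i)) = 1\<^sub>m n"
    "mat_diag n (\<lambda>i. inverse (f i)) * mat_diag n f = 1\<^sub>m n"
    unfolding mat_diag_diag using assms by (auto simp: mat_diag_def)
qed simp_all

text \<open>This is \<open>(H * S * K)\<close> inverted factor by factor, solved for the inverse of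
  \<open>S\<close> so that no inverse of \<open>H\<close> or \<open>K\<close> appears.\<close>

lemma mat_inv_sandwich:
  fixes S :: "'a::field mat"
  assumes H: "H \<in> carrier_mat n n" "invertible_mat H"
    and K: "K \<in> carrier_mat n n" "invertible_mat K"
    and S: "S \<in> carrier_mat n n" "invertible_mat S"
  shows "mat_inv S = K * mat_inv (H * S * K) * H"
proof (rule mat_inv_eqI)
  let ?T = "H * S * K"
  define T' where "T' = mat_inv ?T"
  have "?T \<in> carrier_mat n n" "invertible_mat ?T"
    using H K S by (simp_all add: invertible_mat_mult[of _ n])
  note T = mat_inv_inverse[OF this, folded T'_def]
  note carr = H(1) K(1) S(1) T(1)
  note assoc = assoc_mult_mat[of _ n n _ n _ n]
  \<comment> \<open>Regrouping \<open>?T * T' = 1\<close> shows a right inverse of \<open>H\<close>.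
    For square matrices it is also a left inverse, so \<open>H\<close> may move to the far
    right.\<close>
  have "H * (S * K * T') = 1\<^sub>m n"
    using T(2) carr by (simp add: assoc)
  then have "(S * K * T') * H = 1\<^sub>m n"
    by (rule mat_mult_left_right_inverse[rotated 2]) (use carr in auto)
  then show "S * (K * mat_inv ?T * H) = 1\<^sub>m n"
    unfolding T'_def[symmetric] using carr by (simp add: assoc)
  \<comment> \<open>In the same way, \<open>T' * ?T = 1\<close> lets \<open>K\<close> move from the
    far right to the far left.\<close>
  have "(T' * H * S) * K = 1\<^sub>m n"
    using T(3) carr by (simp add: assoc)
  then have "K * (T' * H * S) = 1\<^sub>m n"
    by (rule mat_mult_left_right_inverse[rotated 2]) (use carr in auto)
  then show "(K * mat_inv ?T * H) * S = 1\<^sub>m n"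
    unfolding T'_def[symmetric] using carr by (simp add: assoc)
  show "S \<in> carrier_mat n n" "K * mat_inv ?T * H \<in> carrier_mat n n"
    unfolding T'_def[symmetric] using carr by auto
qed

text \<open>Turns the matrix relation into scalar identities in the diagonal entries
  \<open>h\<close> and \<open>k\<close>; the solidity and uniqueness arguments then only compare
  entries.\<close>

lemma diag_equiv_entries:
  assumes ST: "(S, T) \<in> diag_equiv d" and S: "invertible_mat (S :: 'a::field mat)"
  obtains h k where "\<forall>i\<le>d. h i \<noteq> 0" "\<forall>i\<le>d. k i \<noteq> 0"
    "\<forall>i\<le>d. \<forall>j\<le>d. T $$ (i, j) = h i * S $$ (i, j) * k j"
    "\<forall>i\<le>d. \<forall>j\<le>d. mat_inv S $$ (i, j) = k i * mat_inv T $$ (i, j) * h j"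
    "invertible_mat T"
proof -
  let ?n = "d + 1"
  obtain H K where S': "S \<in> carrier_mat ?n ?n"
    and H: "H \<in> carrier_mat ?n ?n" "diagonal_mat H" "invertible_mat H"
    and K: "K \<in> carrier_mat ?n ?n" "diagonal_mat K" "invertible_mat K"
    and T: "T = H * S * K"
    using ST unfolding diag_equiv_def by auto
  have T': "T \<in> carrier_mat ?n ?n" "invertible_mat T"
    using H K S S' unfolding T by (simp_all add: invertible_mat_mult[of _ ?n])
  have inv: "mat_inv S = K * mat_inv T * H"
    unfolding T using mat_inv_sandwich[OF H(1,3) K(1,3) S' S] .
  show thesis
  proof (rule that[of "\<lambda>i. H $$ (i, i)" "\<lambda>i. K $$ (i, i)"])
    show "\<forall>i\<le>d. H $$ (i, i) \<noteq> 0" "\<forall>i\<le>d. K $$ (i, i) \<noteq> 0"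
      using diagonal_mat_diag_nonzero[OF H] diagonal_mat_diag_nonzero[OF K] by auto
    show "\<forall>i\<le>d. \<forall>j\<le>d. T $$ (i, j) = H $$ (i, i) * S $$ (i, j) * K $$ (j, j)"
      unfolding T using diagonal_mat_sandwich_entry[OF H(1,2) K(1,2) S'] by simp
    show "\<forall>i\<le>d. \<forall>j\<le>d. mat_inv S $$ (i, j) = K $$ (i, i) * mat_inv T $$ (i, j) * H $$ (j, j)"
      unfolding inv
      using diagonal_mat_sandwich_entry[OF K(1,2) H(1,2) mat_inv_inverse(1)[OF T']] by simp
  qed (rule T'(2))
qed

text \<open>Scaling rows and columns by nonzero factors does not change which entries vanish, in the
  matrix or in its inverse.\<close>

lemma diag_equiv_solid_inv:
  assumes ST: "(S, T) \<in> diag_equiv d" and S: "solid_inv d (S :: 'a::field mat)"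
  shows "solid_inv d T"
proof -
  have inv: "invertible_mat S" using S unfolding solid_inv_def by simp
  obtain h k where *: "\<forall>i\<le>d. h i \<noteq> 0" "\<forall>i\<le>d. k i \<noteq> 0"
    "\<forall>i\<le>d. \<forall>j\<le>d. T $$ (i, j) = h i * S $$ (i, j) * k j"
    "\<forall>i\<le>d. \<forall>j\<le>d. mat_inv S $$ (i, j) = k i * mat_inv T $$ (i, j) * h j"
    "invertible_mat T"
    by (rule diag_equiv_entries[OF ST inv])
  \<comment> \<open>The entry of \<open>mat_inv S\<close> is a product with the entry of
    \<open>mat_inv T\<close> as a factor.\<close>
  have "mat_inv S $$ (i, j) \<noteq> 0 \<Longrightarrow> mat_inv T $$ (i, j) \<noteq> 0" if "i \<le> d" "j \<le> d" for i j
    using *(4) that by auto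
  moreover have "T \<in> carrier_mat (d + 1) (d + 1)"
    using ST unfolding diag_equiv_def by simp
  ultimately show ?thesis
    using S *(1-3,5) unfolding solid_inv_def by simp
qed

lemma normalized_exists:
  assumes S: "solid_inv d (S :: 'a::field mat)"
  obtains T where "(S, T) \<in> diag_equiv d" "normalized d T"
proof -
  let ?n = "d + 1"
  let ?S' = "mat_inv S"
  define h where "h i = 1 / S $$ (i, 0)" for i
  define k where "k i = ?S' $$ (i, 0) / ?S' $$ (0, 0)" for i
  have S': "S \<in> carrier_mat ?n ?n" "invertible_mat S"
    and nz: "\<And>i. i \<le> d \<Longrightarrow> S $$ (i, 0) \<noteq> 0" "\<And>i. i \<le> d \<Longrightarrow> ?S' $$ (i, 0) \<noteq> 0"
    using S unfolding solid_inv_def by auto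
  have hk: "\<And>i. i \<le> d \<Longrightarrow> h i \<noteq> 0" "\<And>i. i \<le> d \<Longrightarrow> k i \<noteq> 0"
    using nz unfolding h_def k_def by auto
  define H where "H = mat_diag ?n h"
  define K where "K = mat_diag ?n k"
  have H: "H \<in> carrier_mat ?n ?n" "diagonal_mat H" "invertible_mat H"
    and K: "K \<in> carrier_mat ?n ?n" "diagonal_mat K" "invertible_mat K"
    using hk by (auto simp: H_def K_def mat_diag_diagonal_mat intro!: invertible_mat_diag)
  define T where "T = H * S * K"
  have T: "T \<in> carrier_mat ?n ?n" "invertible_mat T"
    using H K S' unfolding T_def by (simp_all add: invertible_mat_mult[of _ ?n])
  have ST: "(S, T) \<in> diag_equiv d"
    using H K S' T unfolding diag_equiv_def T_def by blast
  have "T $$ (i, 0) = 1" if "i \<le> d" for i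
  proof -
    \<comment> \<open>Here \<open>k 0 = 1\<close>, so \<open>h i\<close> alone normalizes column
      0.\<close>
    have "T $$ (i, 0) = h i * S $$ (i, 0) * k 0"
      using diagonal_mat_sandwich_entry[OF H(1,2) K(1,2) S'(1), of i 0] that
      by (simp add: T_def H_def K_def mat_diag_def)
    then show ?thesis using nz that by (simp add: h_def k_def)
  qed
  \<comment> \<open>The numerator of \<open>k i\<close> cancels the entry of \<open>?S'\<close> in
    row \<open>i\<close>, leaving a value independent of \<open>i\<close>.\<close>
  moreover have "mat_inv T $$ (i, 0) = ?S' $$ (0, 0) * S $$ (0, 0)" if "i \<le> d" for i
  proof -
    have "?S' $$ (i, 0) = k i * mat_inv T $$ (i, 0) * h 0"
      using diagonal_mat_sandwich_entry[OF K(1,2) H(1,2) mat_inv_inverse(1)[OF T], of i 0] that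
        mat_inv_sandwich[OF H(1,3) K(1,3) S'(1,2)]
      by (simp add: T_def H_def K_def mat_diag_def)
    then show ?thesis using nz(1)[of 0] nz(2)[of 0] nz(2)[OF that]
      by (simp add: h_def k_def field_simps)
  qed
  ultimately have "normalized d T"
    using diag_equiv_solid_inv[OF ST S] unfolding normalized_def by simp
  with ST that show thesis by blast
qed

lemma normalized_diag_equiv_eq:
  assumes RT: "(R, T) \<in> diag_equiv d"
    and R: "normalized d (R :: 'a::field mat)" and T: "normalized d T"
  shows "R = T"
proof -
  have inv: "invertible_mat R" using R unfolding normalized_def solid_inv_def by simp
  obtain h k where h: "\<forall>i\<le>d. h i \<noteq> 0" "\<forall>i\<le>d. k i \<noteq> 0"
    and T_entry: "\<forall>i\<le>d. \<forall>j\<le>d. T $$ (i, j) = h i * R $$ (i, j) * k j"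
    and inv_entry:
      "\<forall>i\<le>d. \<forall>j\<le>d. mat_inv R $$ (i, j) = k i * mat_inv T $$ (i, j) * h j"
    and "invertible_mat T"
    by (rule diag_equiv_entries[OF RT inv])
  have hk: "h i * k 0 = 1" if "i \<le> d" for i
    using T_entry[rule_format, OF that, of 0] that R T unfolding normalized_def by simp
  have k: "k i = k 0" if "i \<le> d" for i
  proof -
    have "mat_inv R $$ (i, 0) = mat_inv R $$ (0, 0)" "mat_inv T $$ (i, 0) = mat_inv T $$ (0, 0)"
      using that R T unfolding normalized_def by blast+
    \<comment> \<open>Solidity makes the common value of column 0 of \<open>mat_inv T\<close>
      nonzero; it and \<open>h 0\<close> can be cancelled when rows \<open>i\<close> and 0 are
      compared.\<close>
    moreover have "mat_inv T $$ (0, 0) \<noteq> 0"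
      using T unfolding normalized_def solid_inv_def by simp
    ultimately show ?thesis
      using inv_entry[rule_format, OF that, of 0] inv_entry[rule_format, of 0 0] h(1) by simp
  qed
  have "T $$ (i, j) = R $$ (i, j)" if "i \<le> d" "j \<le> d" for i j
  proof -
    have "T $$ (i, j) = (h i * k 0) * R $$ (i, j)"
      using T_entry[rule_format, OF that] k[OF that(2)] by (simp add: ac_simps)
    then show ?thesis using hk[OF that(1)] by simp
  qed
  then show ?thesis
    using RT unfolding diag_equiv_def by (intro eq_matI) auto
qed

theorem proposition6p3:
  fixes d :: nat
    and C :: "'a::field mat set"
  assumes "C \<in> {R. solid_inv d R} // diag_equiv d"
  shows "\<exists>!R. R \<in> C \<and> normalized d R"
proof -
  obtain S where S: "solid_inv d S" and C: "C = diag_equiv d `` {S}"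
    using assms unfolding quotient_def by blast
  obtain T where T: "(S, T) \<in> diag_equiv d" "normalized d T"
    by (rule normalized_exists[OF S])
  have "R = T" if R: "R \<in> C" "normalized d R" for R
  proof -
    \<comment> \<open>\<open>R\<close> and \<open>T\<close> are both related to the representative
      \<open>S\<close>, hence to each other by symmetry and transitivity.\<close>
    have "(S, R) \<in> diag_equiv d" using R(1) C by simp
    then have "(R, T) \<in> diag_equiv d"
      using T(1) equiv_diag_equiv[of d] by (meson equivE symE transE)
    then show ?thesis using R(2) T(2) by (rule normalized_diag_equiv_eq)
  qed
  then show ?thesis using T C by blast
qed

end
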